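(* Let $m\ge1$ be an integer and let $C=a\,C_a\oplus b\,C_b$ be an $H_{23}$-code of length $n=2m$, with binary component $C_a\subseteq\mathbb{F}_2^{n}$ and ternary component $C_b\subseteq\mathbb{F}_3^{n}$. Then $C$ is a symplectic quasi self-dual (symplectic-QSD) code if and only if $C_a$ is a binary symplectic self-dual code and $C_b$ is a ternary $[n,m]$ code.
   Context: Ring: $H_{23}=\langle a,b\mid 2a=0,\ 3b=0,\ a^2=a,\ b^2=0,\ ab=ba=0\rangle$ is the commutative non-unital ring of order six with elements $0,a,b,a+b,2b,a+2b$. For $\mathbf{x}\in\mathbb{F}_2^n$, $a\mathbf{x}$ is the vector obtained coordinatewise from $a\cdot0=0$, $a\cdot1=a$; for $\mathbf{y}\in\mathbb{F}_3^n$, $b\mathbf{y}$ is obtained coordinatewise from $b\cdot0=0$, $b\cdot1=b$, $b\cdot2=2b$. Every vector of $H_{23}^n$ is uniquely $a\mathbf{x}+b\mathbf{y}$ with $\mathbf{x}\in\mathbb{F}_2^n$, $\mathbf{y}\in\mathbb{F}_3^n$. Codes: an $H_{23}$-code of length $n$ is an $H_{23}$-submodule $C\subseteq H_{23}^n$ (an additive subgroup closed under multiplication by elements of $H_{23}$). It decomposes as $C=aC_a\oplus bC_b=\{a\mathbf{u}+b\mathbf{v}: \mathbf{u}\in C_a,\mathbf{v}\in C_b\}$ with $C_a=\{\mathbf{u}\in\mathbb{F}_2^n: a\mathbf{u}\in C\}$ and $C_b=\{\mathbf{v}\in\mathbb{F}_3^n: b\mathbf{v}\in C\}$, which are linear codes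 over $\mathbb{F}_2$ and $\mathbb{F}_3$ respectively. A linear code of length $n$ and dimension $k$ over $\mathbb{F}_p$ is called an $[n,k]$ code. Symplectic forms: for $\mathbf{x}=(\mathbf{x}_1\mid\mathbf{x}_2),\mathbf{y}=(\mathbf{y}_1\mid\mathbf{y}_2)\in\mathbb{F}_2^{2m}$ with $\mathbf{x}_i,\mathbf{y}_i\in\mathbb{F}_2^m$, set $\langle\mathbf{x},\mathbf{y}\rangle_s^{(\mathbb{F}_2)}=\mathbf{x}_1\cdot\mathbf{y}_2+\mathbf{x}_2\cdot\mathbf{y}_1$, where $\cdot$ is the usual dot product. For $\mathbf{c}=a\mathbf{x}+b\mathbf{y}$, $\mathbf{c}'=a\mathbf{x}'+b\mathbf{y}'$ in $H_{23}^{2m}$ (with $\mathbf{x},\mathbf{x}'\in\mathbb{F}_2^{2m}$, $\mathbf{y},\mathbf{y}'\in\mathbb{F}_3^{2m}$), set $\langle\mathbf{c},\mathbf{c}'\rangle_S=a\langle\mathbf{x},\mathbf{x}'\rangle_s^{(\mathbb{F}_2)}$ (the ternary part contributes $0$ because $b^2=0$). The symplectic dual $C^{\perp_S}$ of a code $C$ (over $\mathbb{F}_2$ or $H_{23}$, of length $2m$) is the set of all vectors of the ambient space orthogonal to every element of $C$ under the corresponding symplectic form. $C$ is symplectic self-orthogonal if $C\subseteq C^{\perp_S}$ and symplectic self-dual if $C=C^{\perp_S}$. An $H_{23}$-code of length $2m$ is symplectic quasi self-dual (symplectic-QSD) if it is symplectic self-orthogonal and has exactly $6^m$ elements. *)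

theory Defs
  imports "HOL-Analysis.Analysis" "HOL-Library.Z2"
begin

section \<open>The prime fields of order two and three\<close>

type_synonym f2 = bit
type_synonym f3 = Enum.finite_3

lemma UNIV_f2: "(UNIV :: f2 set) = {0, 1}"
  by (auto intro: bit.exhaust)

lemma UNIV_f3: "(UNIV :: f3 set) = {0, 1, 2}"
  by (auto simp: zero_finite_3_def one_finite_3_def uminus_finite_3_def two_finite_3
      intro: finite_3.exhaust)

lemma CARD_f3: "CARD(f3) = 3"
  by (simp add: UNIV_finite_3)

section \<open>The ring of order six\<close>

text \<open>
  The element \<open>H23 x y\<close> is \<open>ax + by\<close>. Since \<open>a\<^sup>2 = a\<close> and \<open>b\<^sup>2 = ab = ba = 0\<close>, only the binary
  coordinates contribute to a product. The ring has no unit; the class \<open>comm_ring\<close> does not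
  ask for one.
\<close>

datatype h23 = H23 (bin: f2) (ter: f3)

instantiation h23 :: comm_ring
begin

definition zero_h23 :: h23 where "0 = H23 0 0"
definition plus_h23 :: "h23 \<Rightarrow> h23 \<Rightarrow> h23" where "r + s = H23 (bin r + bin s) (ter r + ter s)"
definition uminus_h23 :: "h23 \<Rightarrow> h23" where "- r = H23 (- bin r) (- ter r)"
definition minus_h23 :: "h23 \<Rightarrow> h23 \<Rightarrow> h23" where "r - s = H23 (bin r - bin s) (ter r - ter s)"
definition times_h23 :: "h23 \<Rightarrow> h23 \<Rightarrow> h23" where "r * s = H23 (bin r * bin s) 0"

instance
  by standard (auto simp: zero_h23_def plus_h23_def uminus_h23_def minus_h23_def times_h23_def
      algebra_simps intro: h23.expand)

end

definition gen_a :: h23 where "gen_a = H23 1 0"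
definition gen_b :: h23 where "gen_b = H23 0 1"

lemma h23_relations:
  "gen_a + gen_a = 0" "gen_b + gen_b + gen_b = 0"
  "gen_a * gen_a = gen_a" "gen_b * gen_b = 0" "gen_a * gen_b = 0" "gen_b * gen_a = 0"
  by (simp_all add: gen_a_def gen_b_def zero_h23_def plus_h23_def times_h23_def
      one_finite_3_def zero_finite_3_def plus_finite_3_def)

lemma UNIV_h23:
  "(UNIV :: h23 set) = {0, gen_a, gen_b, gen_a + gen_b, gen_b + gen_b, gen_a + (gen_b + gen_b)}"
proof -
  have "r \<in> {0, gen_a, gen_b, gen_a + gen_b, gen_b + gen_b, gen_a + (gen_b + gen_b)}" for r
    by (cases r, cases "bin r"; cases "ter r")
      (simp_all add: gen_a_def gen_b_def zero_h23_def plus_h23_def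
        one_finite_3_def zero_finite_3_def plus_finite_3_def)
  then show ?thesis by blast
qed

lemma CARD_h23: "CARD(h23) = 6"
  by (simp add: UNIV_h23 gen_a_def gen_b_def zero_h23_def plus_h23_def
      one_finite_3_def zero_finite_3_def plus_finite_3_def)

definition a_times :: "f2 \<Rightarrow> h23"
  where "a_times x = (if x = 0 then 0 else gen_a)"

definition b_times :: "f3 \<Rightarrow> h23"
  where "b_times y = (if y = 0 then 0 else if y = 1 then gen_b else gen_b + gen_b)"

definition a_vec :: "f2 ^ 'n \<Rightarrow> h23 ^ 'n"
  where "a_vec x = (\<chi> i. a_times (x $ i))"

definition b_vec :: "f3 ^ 'n \<Rightarrow> h23 ^ 'n"
  where "b_vec y = (\<chi> i. b_times (y $ i))"

text \<open>The binary coordinate vector of \<open>c = ax + by\<close> is \<open>x\<close>.\<close>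

definition bin_vec :: "h23 ^ 'n \<Rightarrow> f2 ^ 'n"
  where "bin_vec c = (\<chi> i. bin (c $ i))"

definition ter_vec :: "h23 ^ 'n \<Rightarrow> f3 ^ 'n"
  where "ter_vec c = (\<chi> i. ter (c $ i))"

lemma a_times_eq: "a_times x = H23 x 0"
  by (cases x) (simp_all add: a_times_def gen_a_def zero_h23_def)

lemma b_times_eq: "b_times y = H23 0 y"
  by (cases y) (simp_all add: b_times_def gen_b_def zero_h23_def plus_h23_def
      one_finite_3_def zero_finite_3_def plus_finite_3_def)

lemma h23_vec_decomposition:
  "c = a_vec x + b_vec y \<longleftrightarrow> x = bin_vec c \<and> y = ter_vec c"
proof -
  have "a_times u + b_times v = H23 u v" for u v
    by (simp only: a_times_eq b_times_eq plus_h23_def h23.sel add_0_left add_0_right)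
  then have "c = a_vec x + b_vec y \<longleftrightarrow> (\<forall>i. c $ i = H23 (x $ i) (y $ i))"
    by (simp add: vec_eq_iff a_vec_def b_vec_def)
  also have "\<dots> \<longleftrightarrow> (\<forall>i. x $ i = bin (c $ i) \<and> y $ i = ter (c $ i))"
    by (metis h23.sel h23.collapse)
  finally show ?thesis
    by (auto simp: vec_eq_iff bin_vec_def ter_vec_def)
qed

section \<open>Codes\<close>

definition linear_code :: "nat \<Rightarrow> nat \<Rightarrow> ('q::field ^ 'n) set \<Rightarrow> bool"
  where "linear_code n k C \<longleftrightarrow> CARD('n) = n \<and> vec.subspace C \<and> vec.dim C = k"

definition h23_code :: "(h23 ^ 'n) set \<Rightarrow> bool"
  where "h23_code C \<longleftrightarrow> 0 \<in> C \<and> (\<forall>c\<in>C. \<forall>d\<in>C. c + d \<in> C) \<and> (\<forall>c\<in>C. - c \<in> C) \<and>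
    (\<forall>r. \<forall>c\<in>C. r *s c \<in> C)"

definition binary_part :: "(h23 ^ 'n) set \<Rightarrow> (f2 ^ 'n) set"
  where "binary_part C = {u. a_vec u \<in> C}"

definition ternary_part :: "(h23 ^ 'n) set \<Rightarrow> (f3 ^ 'n) set"
  where "ternary_part C = {v. b_vec v \<in> C}"

lemma h23_code_decomposition:
  assumes "h23_code C"
  shows "C = {a_vec u + b_vec v | u v. u \<in> binary_part C \<and> v \<in> ternary_part C}"
proof (intro set_eqI iffI)
  fix c assume c: "c \<in> C"
  have a: "a_vec (bin_vec c) = gen_a *s c"
    by (simp add: vec_eq_iff a_vec_def bin_vec_def a_times_eq gen_a_def times_h23_def)
  have c_eq: "c = a_vec (bin_vec c) + b_vec (ter_vec c)"
    by (simp add: h23_vec_decomposition)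
  have ac: "a_vec (bin_vec c) \<in> C"
    using assms c unfolding a h23_code_def by blast
  have "b_vec (ter_vec c) = c + - a_vec (bin_vec c)"
    by (subst (2) c_eq) simp
  also have "\<dots> \<in> C"
    using assms c ac unfolding h23_code_def by blast
  finally show "c \<in> {a_vec u + b_vec v | u v. u \<in> binary_part C \<and> v \<in> ternary_part C}"
    using c_eq ac unfolding binary_part_def ternary_part_def by blast
next
  fix c assume "c \<in> {a_vec u + b_vec v | u v. u \<in> binary_part C \<and> v \<in> ternary_part C}"
  then show "c \<in> C"
    using assms unfolding h23_code_def binary_part_def ternary_part_def by blast
qed

section \<open>Symplectic forms and duals\<close>

text \<open>
  Vectors of length \<open>2m\<close> are indexed by \<open>'m + 'm\<close> with \<open>m = CARD('m)\<close>: the \<open>Inl\<close> coordinates of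
  \<open>(x\<^sub>1 | x\<^sub>2)\<close> form \<open>x\<^sub>1\<close> and the \<open>Inr\<close> coordinates form \<open>x\<^sub>2\<close>.
\<close>

definition left_half :: "'q ^ ('m::finite + 'm) \<Rightarrow> 'q ^ 'm"
  where "left_half x = (\<chi> i. x $ Inl i)"

definition right_half :: "'q ^ ('m::finite + 'm) \<Rightarrow> 'q ^ 'm"
  where "right_half x = (\<chi> i. x $ Inr i)"

definition dot :: "'q::semiring_0 ^ 'm \<Rightarrow> 'q ^ 'm \<Rightarrow> 'q"
  where "dot x y = (\<Sum>i\<in>UNIV. x $ i * y $ i)"

definition symp_f2 :: "f2 ^ ('m::finite + 'm) \<Rightarrow> f2 ^ ('m::finite + 'm) \<Rightarrow> f2"
  where "symp_f2 x y = dot (left_half x) (right_half y) + dot (right_half x) (left_half y)"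

definition symp_h23 :: "h23 ^ ('m::finite + 'm) \<Rightarrow> h23 ^ ('m::finite + 'm) \<Rightarrow> h23"
  where "symp_h23 c d = a_times (symp_f2 (bin_vec c) (bin_vec d))"

definition symp_dual_f2 :: "(f2 ^ ('m::finite + 'm)) set \<Rightarrow> (f2 ^ ('m::finite + 'm)) set"
  where "symp_dual_f2 C = {x. \<forall>y\<in>C. symp_f2 x y = 0}"

definition symp_dual_h23 :: "(h23 ^ ('m::finite + 'm)) set \<Rightarrow> (h23 ^ ('m::finite + 'm)) set"
  where "symp_dual_h23 C = {c. \<forall>d\<in>C. symp_h23 c d = 0}"

definition symp_self_dual_f2_code :: "(f2 ^ ('m::finite + 'm)) set \<Rightarrow> bool"
  where "symp_self_dual_f2_code C \<longleftrightarrow> vec.subspace C \<and> C = symp_dual_f2 C"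

definition symp_self_orthogonal_h23 :: "(h23 ^ ('m::finite + 'm)) set \<Rightarrow> bool"
  where "symp_self_orthogonal_h23 C \<longleftrightarrow> C \<subseteq> symp_dual_h23 C"

definition symp_QSD :: "(h23 ^ ('m::finite + 'm)) set \<Rightarrow> bool"
  where "symp_QSD C \<longleftrightarrow> h23_code C \<and> symp_self_orthogonal_h23 C \<and> card C = 6 ^ CARD('m)"

end

theory Submission
  imports Defs
begin

text \<open>
  A code has \<open>card C\<^sub>a * card C\<^sub>b\<close> elements and is self-orthogonal iff \<open>C\<^sub>a\<close> is. Summing the character
  \<open>(-1)\<^bsup>\<langle>x,y\<rangle>\<^esup>\<close> over \<open>x \<in> C\<^sub>a\<close> and all \<open>y\<close> in the two possible orders shows that \<open>C\<^sub>a\<close> and its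
  symplectic dual have orders with product \<open>4\<^bsup>m\<^esup>\<close>. So \<open>card C\<^sub>a\<close> is a power of two, while \<open>card C\<^sub>b\<close> is
  a power of three, and comparing both factors of \<open>6\<^bsup>m\<^esup> = 2\<^bsup>m\<^esup> * 3\<^bsup>m\<^esup>\<close> gives the equivalence.
\<close>

section \<open>Additive subgroups and subspaces\<close>

instance bit :: finite
  by standard (simp add: UNIV_f2)

lemma CARD_f2: "CARD(f2) = 2"
  by (simp add: UNIV_f2)

text \<open>Subgroups are the common ground: character sums need only addition, and over the two
  prime fields subgroups are already subspaces.\<close>

definition add_closed :: "'g::ab_group_add set \<Rightarrow> bool"
  where "add_closed S \<longleftrightarrow> 0 \<in> S \<and> (\<forall>x\<in>S. \<forall>y\<in>S. x + y \<in> S) \<and> (\<forall>x\<in>S. - x \<in> S)"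

lemma subspace_f2_iff_add_closed:
  fixes S :: "(f2 ^ 'n) set"
  shows "vec.subspace S \<longleftrightarrow> add_closed S"
proof
  assume S: "add_closed S"
  have "c *s x \<in> S" if "x \<in> S" for c x
    using S that by (cases c) (simp_all add: add_closed_def)
  with S show "vec.subspace S"
    by (auto simp: add_closed_def intro: vec.subspaceI)
qed (auto simp: add_closed_def vec.subspace_0 vec.subspace_add vec.subspace_neg)

text \<open>Every scalar of a prime field is a sum of ones, here 0, 1 or 1 + 1, so scaling is
  repeated addition.\<close>

lemma subspace_f3_iff_add_closed:
  fixes S :: "(f3 ^ 'n) set"
  shows "vec.subspace S \<longleftrightarrow> add_closed S"
proof
  assume S: "add_closed S"
  have "c *s x \<in> S" if x: "x \<in> S" for c x
  proof -
    consider "c = 0" | "c = 1" | "c = 1 + 1"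
      using UNIV_f3 by (metis UNIV_I insertE one_add_one singletonD)
    then show ?thesis
    proof cases
      case 1
      then have "c *s x = 0" by (simp only: vec.scale_zero_left)
      then show ?thesis using S unfolding add_closed_def by metis
    next
      case 2
      then have "c *s x = x" by (simp only: vec.scale_one)
      then show ?thesis using x by metis
    next
      case 3
      then have "c *s x = x + x"
        by (simp only: vec.scale_left_distrib vec.scale_one)
      then show ?thesis using S x unfolding add_closed_def by metis
    qed
  qed
  with S show "vec.subspace S"
    by (auto simp: add_closed_def intro: vec.subspaceI)
qed (auto simp: add_closed_def vec.subspace_0 vec.subspace_add vec.subspace_neg)

text \<open>Adjoining \<open>b\<close> outside the span of \<open>B\<close> multiplies the size by
  the order of the field, because the representation \<open>c *s b + x\<close> is unique.\<close>

lemma card_span_independent: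
  fixes B :: "('q::{field,finite} ^ 'n) set"
  assumes "finite B" "vec.independent B"
  shows "card (vec.span B) = CARD('q) ^ card B"
  using assms
proof (induction B)
  case empty
  then show ?case by simp
next
  case (insert b B)
  then have b: "b \<notin> vec.span B" and B: "vec.independent B"
    by (auto simp: vec.independent_insert)
  let ?f = "\<lambda>(c, x). c *s b + x"
  have "vec.span (insert b B) = ?f ` (UNIV \<times> vec.span B)"
  proof (intro equalityI subsetI)
    fix x assume "x \<in> vec.span (insert b B)"
    then obtain c where "x - c *s b \<in> vec.span B"
      by (auto simp: vec.span_insert)
    then show "x \<in> ?f ` (UNIV \<times> vec.span B)"
      by (intro image_eqI[of _ _ "(c, x - c *s b)"]) auto
  next
    fix y assume "y \<in> ?f ` (UNIV \<times> vec.span B)"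
    then obtain c x where "x \<in> vec.span B" "y = c *s b + x" by auto
    then have "y - c *s b \<in> vec.span B" by simp
    then show "y \<in> vec.span (insert b B)"
      by (auto simp: vec.span_insert)
  qed
  moreover have "inj_on ?f (UNIV \<times> vec.span B)"
  proof (rule inj_onI, clarify)
    fix c x d y
    assume x: "x \<in> vec.span B" and y: "y \<in> vec.span B" and eq: "c *s b + x = d *s b + y"
    have "(c - d) *s b = y - x"
      using eq by (simp add: vec.scale_left_diff_distrib algebra_simps)
    then have *: "(c - d) *s b \<in> vec.span B"
      using x y by (simp add: vec.span_diff)
    \<comment> \<open>Otherwise scaling by the inverse of \<open>c - d\<close> would put
      \<open>b\<close> itself into \<open>vec.span B\<close>.\<close>
    have "c = d"
    proof (rule ccontr)
      assume "c \<noteq> d"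
      then have "inverse (c - d) *s ((c - d) *s b) = b"
        by (simp only: vec.scale_scale) simp
      with * b show False by (metis vec.span_scale)
    qed
    with eq show "c = d \<and> x = y" by simp
  qed
  ultimately have "card (vec.span (insert b B)) = CARD('q) * card (vec.span B)"
    by (simp add: card_image card_cartesian_product)
  with insert B show ?case by simp
qed

lemma card_subspace:
  fixes S :: "('q::{field,finite} ^ 'n) set"
  assumes "vec.subspace S"
  shows "card S = CARD('q) ^ vec.dim S"
proof -
  obtain B where B: "B \<subseteq> S" "vec.independent B" "S \<subseteq> vec.span B" "card B = vec.dim S"
    using vec.basis_exists by metis
  then have "vec.span B = S"
    using assms vec.span_minimal by blast
  with B card_span_independent[OF finite B(2)] show ?thesis by simp
qed

section \<open>The size of the symplectic dual\<close>

text \<open>The nontrivial character of the additive group of order two, with integer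
  values.\<close>

definition sign :: "f2 \<Rightarrow> int"
  where "sign x = (if x = 0 then 1 else - 1)"

lemma sign_add: "sign (x + y) = sign x * sign y"
  by (cases x; cases y) (simp_all add: sign_def)

text \<open>Orthogonality of characters: translation by some \<open>z\<close> in \<open>S\<close>
  with \<open>h z \<noteq> 0\<close> permutes \<open>S\<close> and flips every sign, so the sum
  equals its own negative.\<close>

lemma sum_sign_additive:
  fixes h :: "'g::ab_group_add \<Rightarrow> f2"
  assumes S: "add_closed S" and h: "\<And>x y. h (x + y) = h x + h y"
  shows "(\<Sum>x\<in>S. sign (h x)) = (if \<forall>x\<in>S. h x = 0 then int (card S) else 0)"
proof (cases "\<forall>x\<in>S. h x = 0")
  case True
  then show ?thesis by (simp add: sign_def)
next
  case False
  then obtain z where z: "z \<in> S" "h z \<noteq> 0" by blast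
  have "bij_betw (\<lambda>x. z + x) S S"
  proof (rule bij_betw_byWitness[where f' = "\<lambda>x. - z + x"])
    show "(\<lambda>x. - z + x) ` S \<subseteq> S" "(\<lambda>x. z + x) ` S \<subseteq> S"
      using S z unfolding add_closed_def by blast+
  qed auto
  then have "(\<Sum>x\<in>S. sign (h x)) = (\<Sum>x\<in>S. sign (h (z + x)))"
    by (rule sum.reindex_bij_betw[symmetric])
  also have "\<dots> = - (\<Sum>x\<in>S. sign (h x))"
    using z by (simp only: h sign_add sign_def[of "h z"] if_False mult_minus1 sum_negf)
  finally have "(\<Sum>x\<in>S. sign (h x)) = 0" by simp
  with False show ?thesis by (simp only: if_False)
qed

lemma dot_commute: "dot x y = dot y (x :: 'q::comm_semiring_0 ^ 'm)"
  by (simp add: dot_def mult.commute)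

lemma dot_add_left: "dot (x + y) z = dot x z + dot y z"
  by (simp add: dot_def distrib_right sum.distrib)

lemma symp_f2_commute: "symp_f2 x y = symp_f2 y x"
  unfolding symp_f2_def by (subst add.commute) (simp only: dot_commute)

lemma symp_f2_add_left: "symp_f2 (x + y) z = symp_f2 x z + symp_f2 y z"
proof -
  have "left_half (x + y) = left_half x + left_half y" "right_half (x + y) = right_half x + right_half y"
    by (simp_all add: left_half_def right_half_def vec_eq_iff)
  then show ?thesis
    by (simp only: symp_f2_def dot_add_left ac_simps)
qed

text \<open>Pairing with the unit vector at the mirror position in the other half reads off a
  coordinate of \<open>x\<close>.\<close>

lemma symp_f2_nondegenerate:
  assumes "\<And>y. symp_f2 x y = 0"
  shows "x = 0"
proof -
  have "x $ i = 0" for i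
  proof (cases i)
    case (Inl j)
    have "symp_f2 x (axis (Inr j) 1) = x $ i"
      by (simp add: symp_f2_def dot_def left_half_def right_half_def axis_def Inl if_distrib cong: if_cong)
    with assms show ?thesis by simp
  next
    case (Inr j)
    have "symp_f2 x (axis (Inl j) 1) = x $ i"
      by (simp add: symp_f2_def dot_def left_half_def right_half_def axis_def Inr if_distrib cong: if_cong)
    with assms show ?thesis by simp
  qed
  then show ?thesis by (simp add: vec_eq_iff)
qed

lemma card_symp_dual_f2:
  fixes S :: "(f2 ^ ('m::finite + 'm)) set"
  assumes S: "add_closed S"
  shows "card S * card (symp_dual_f2 S) = 4 ^ CARD('m)"
proof -
  let ?V = "UNIV :: (f2 ^ ('m + 'm)) set"
  have V: "add_closed ?V" by (simp add: add_closed_def)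
  have "(\<Sum>x\<in>S. sign (symp_f2 x y)) = (if y \<in> symp_dual_f2 S then int (card S) else 0)" for y
    using sum_sign_additive[of S "\<lambda>x. symp_f2 x y", OF S symp_f2_add_left]
    by (simp only: symp_dual_f2_def mem_Collect_eq symp_f2_commute)
  then have "(\<Sum>y\<in>?V. \<Sum>x\<in>S. sign (symp_f2 x y))
      = (\<Sum>y\<in>?V. if y \<in> symp_dual_f2 S then int (card S) else 0)"
    by simp
  also have "\<dots> = int (card S * card (symp_dual_f2 S))"
    by (simp add: sum.If_cases)
  finally have 1: "(\<Sum>y\<in>?V. \<Sum>x\<in>S. sign (symp_f2 x y)) = int (card S * card (symp_dual_f2 S))" .
  \<comment> \<open>For the other order of summation: by nondegeneracy the character of
    \<open>x\<close> is trivial on the whole space exactly when \<open>x = 0\<close>.\<close>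
  have "symp_f2 0 y = 0" for y :: "f2 ^ ('m + 'm)"
    using symp_f2_add_left[of 0 0 y] by (simp only: add_0_left add_cancel_right_left)
  then have "(\<forall>y. symp_f2 x y = 0) \<longleftrightarrow> x = 0" for x :: "f2 ^ ('m + 'm)"
    using symp_f2_nondegenerate by blast
  then have "(\<Sum>y\<in>?V. sign (symp_f2 x y)) = (if x = 0 then int (card ?V) else 0)"
    for x :: "f2 ^ ('m + 'm)"
    using sum_sign_additive[of ?V "\<lambda>y. symp_f2 y x", OF V symp_f2_add_left]
    by (simp add: symp_f2_commute[of _ x])
  \<comment> \<open>Only the term for \<open>x = 0\<close> survives, and it is present since
    \<open>0 \<in> S\<close>.\<close>
  then have "(\<Sum>x\<in>S. \<Sum>y\<in>?V. sign (symp_f2 x y)) = int (card ?V)"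
    using S by (simp add: add_closed_def)
  then have "int (card S * card (symp_dual_f2 S)) = int (card ?V)"
    using 1 sum.swap[of "\<lambda>x y. sign (symp_f2 x y)" ?V S] by argo
  then have "card S * card (symp_dual_f2 S) = card ?V"
    by (simp only: of_nat_eq_iff)
  also have "\<dots> = 4 ^ CARD('m)"
    using power_mult_distrib[of "2::nat" 2 "CARD('m)"] by (simp add: CARD_vec CARD_f2 power_add)
  finally show ?thesis .
qed

section \<open>Components of a code\<close>

lemma a_vec_linear:
  "a_vec 0 = 0" "a_vec (x + y) = a_vec x + a_vec y" "a_vec (- x) = - a_vec x"
  by (simp_all add: a_vec_def vec_eq_iff a_times_eq zero_h23_def plus_h23_def uminus_h23_def)

lemma b_vec_linear:
  "b_vec 0 = 0" "b_vec (x + y) = b_vec x + b_vec y" "b_vec (- x) = - b_vec x"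
  by (simp_all add: b_vec_def vec_eq_iff b_times_eq zero_h23_def plus_h23_def uminus_h23_def)

lemma add_closed_components:
  assumes "h23_code C"
  shows "add_closed (binary_part C)" "add_closed (ternary_part C)"
  using assms
  by (auto simp: h23_code_def add_closed_def binary_part_def ternary_part_def a_vec_linear b_vec_linear)

lemma bin_vec_a_b: "bin_vec (a_vec x + b_vec y) = x"
  and ter_vec_a_b: "ter_vec (a_vec x + b_vec y) = y"
  using h23_vec_decomposition by metis+

text \<open>The coordinate maps \<open>bin_vec\<close> and \<open>ter_vec\<close> invert the sum
  \<open>a_vec u + b_vec v\<close>, so the code is in bijection with the product of its
  components.\<close>

lemma card_h23_code:
  fixes C :: "(h23 ^ 'n) set"
  assumes "h23_code C"
  shows "card C = card (binary_part C) * card (ternary_part C)"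
proof -
  have "C = (\<lambda>(u, v). a_vec u + b_vec v) ` (binary_part C \<times> ternary_part C)"
    by (subst h23_code_decomposition[OF assms]) auto
  moreover have "inj (\<lambda>(u, v). a_vec u + b_vec v :: h23 ^ 'n)"
    by (rule inj_on_inverseI[where g = "\<lambda>c. (bin_vec c, ter_vec c)"])
      (auto simp: bin_vec_a_b ter_vec_a_b)
  ultimately show ?thesis
    by (metis card_image card_cartesian_product inj_on_subset subset_UNIV)
qed

text \<open>Any \<open>u\<close> in the binary part is reached by pairing it with the zero ternary
  vector. This turns statements about the form on \<open>C\<close>, which sees only
  \<open>bin_vec\<close>, into statements about the binary part.\<close>

lemma bin_vec_image:
  assumes "h23_code C"
  shows "bin_vec ` C = binary_part C"
proof -
  have "0 \<in> ternary_part C"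
    using add_closed_components(2)[OF assms] by (simp add: add_closed_def)
  then show ?thesis
    by (subst h23_code_decomposition[OF assms]) (force simp: bin_vec_a_b image_iff)
qed

lemma symp_self_orthogonal_h23_iff:
  assumes "h23_code C"
  shows "symp_self_orthogonal_h23 C \<longleftrightarrow> binary_part C \<subseteq> symp_dual_f2 (binary_part C)"
proof -
  have "a_times x = 0 \<longleftrightarrow> x = 0" for x
    by (simp add: a_times_eq zero_h23_def)
  then show ?thesis
    unfolding bin_vec_image[OF assms, symmetric]
    by (auto simp: symp_self_orthogonal_h23_def symp_dual_h23_def symp_dual_f2_def symp_h23_def)
qed

text \<open>As a divisor of a power of two, \<open>s\<close> is coprime to 3, so all factors 3 of
  \<open>6 ^ m\<close> lie in \<open>3 ^ k\<close>; conversely \<open>3 ^ k\<close> is coprime to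
  \<open>2 ^ m\<close> and so divides \<open>3 ^ m\<close>.\<close>

lemma power2_power3_split:
  fixes s k m :: nat
  assumes "s dvd 4 ^ m" and "s * 3 ^ k = 6 ^ m"
  shows "s = 2 ^ m \<and> k = m"
proof -
  have six: "(6::nat) ^ m = 2 ^ m * 3 ^ m"
    using power_mult_distrib[of "2::nat" 3 m] by simp
  \<comment> \<open>The cited instance says that 3 + 1 = 4 and 3 are coprime.\<close>
  have c: "coprime (4 ^ m) (3 ^ j :: nat)" "coprime (2 ^ m) (3 ^ j :: nat)" for j
    using coprime_add_one_left[of "3::nat"] by simp_all
  have "coprime (3 ^ m) s"
    using c(1) assms(1) by (metis coprime_commute coprime_divisors dvd_refl)
  moreover have "3 ^ m dvd s * 3 ^ k"
    by (simp add: assms(2) six)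
  ultimately have "(3::nat) ^ m dvd 3 ^ k"
    by (simp add: coprime_dvd_mult_right_iff)
  moreover have "3 ^ k dvd 2 ^ m * (3 ^ m :: nat)"
    using assms(2) six by (metis dvd_triv_right)
  then have "(3::nat) ^ k dvd 3 ^ m"
    using c(2) by (metis coprime_commute coprime_dvd_mult_right_iff)
  ultimately have "k = m"
    by (metis dvd_antisym power_inject_exp one_less_numeral_iff semiring_norm(77))
  with assms(2) six show ?thesis by simp
qed

theorem lemma4p8:
  fixes m :: nat and C :: "(h23 ^ ('m::finite + 'm)) set"
  assumes "m \<ge> 1" and "CARD('m) = m" and "h23_code C"
  shows "symp_QSD C \<longleftrightarrow>
    symp_self_dual_f2_code (binary_part C) \<and> linear_code (2 * m) m (ternary_part C)"
proof -
  let ?A = "binary_part C" and ?B = "ternary_part C"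
  note closed = add_closed_components[OF assms(3)]
  have A: "vec.subspace ?A" and B: "vec.subspace ?B"
    using closed by (simp_all add: subspace_f2_iff_add_closed subspace_f3_iff_add_closed)
  have card_dual: "card ?A * card (symp_dual_f2 ?A) = 4 ^ m"
    using card_symp_dual_f2[OF closed(1)] assms(2) by simp
  have card_B: "card ?B = 3 ^ vec.dim ?B"
    using card_subspace[OF B] by (simp only: CARD_f3)
  have four: "(4::nat) ^ m = 2 ^ m * 2 ^ m" and six: "(6::nat) ^ m = 2 ^ m * 3 ^ m"
    using power_mult_distrib[of "2::nat" 2 m] power_mult_distrib[of "2::nat" 3 m] by simp_all
  have QSD: "symp_QSD C \<longleftrightarrow> ?A \<subseteq> symp_dual_f2 ?A \<and> card ?A * 3 ^ vec.dim ?B = 6 ^ m"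
    using assms by (simp add: symp_QSD_def symp_self_orthogonal_h23_iff card_h23_code card_B)
  have code: "linear_code (2 * m) m ?B \<longleftrightarrow> vec.dim ?B = m"
    using assms(2) B by (simp add: linear_code_def)
  have "?A \<subseteq> symp_dual_f2 ?A \<and> card ?A * 3 ^ vec.dim ?B = 6 ^ m \<longleftrightarrow>
      ?A = symp_dual_f2 ?A \<and> vec.dim ?B = m"
  proof
    assume QSD: "?A \<subseteq> symp_dual_f2 ?A \<and> card ?A * 3 ^ vec.dim ?B = 6 ^ m"
    have "card ?A dvd 4 ^ m"
      by (metis card_dual dvd_triv_left)
    with QSD have k: "card ?A = 2 ^ m" "vec.dim ?B = m"
      using power2_power3_split by blast+
    \<comment> \<open>Cancelling \<open>2 ^ m\<close> in \<open>card_dual\<close> leaves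
      \<open>2 ^ m\<close> for the dual; an inclusion of finite sets of equal size is an
      equality.\<close>
    then have "card (symp_dual_f2 ?A) = card ?A"
      using card_dual four by simp
    with QSD k show "?A = symp_dual_f2 ?A \<and> vec.dim ?B = m"
      by (metis card_subset_eq finite)
  next
    assume dual: "?A = symp_dual_f2 ?A \<and> vec.dim ?B = m"
    \<comment> \<open>Self-duality makes both factors in \<open>card_dual\<close> equal, so the size
      of the binary part is a square root of \<open>4 ^ m\<close>.\<close>
    then have "(card ?A)\<^sup>2 = (2 ^ m)\<^sup>2"
      using card_dual four by (metis power2_eq_square)
    then have "card ?A = 2 ^ m" by simp
    with dual six show "?A \<subseteq> symp_dual_f2 ?A \<and> card ?A * 3 ^ vec.dim ?B = 6 ^ m"
      by simp
  qed
  with QSD code A show ?thesis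
    by (simp add: symp_self_dual_f2_code_def)
qed

end
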